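(* Let $p$ be a prime number, let $k$ be a divisor of $p-1$, and let $A_k=\{x^k : x\in\mathbb{Z}_p^*\}$ be the multiplicative subgroup of $\mathbb{Z}_p^*$ of $k$th powers, with $|A_k|=t=\frac{p-1}{k}$. Then $A_k$ is a generalized arithmetic progression if and only if $t=2$, $t=4$, or $t=p-1$.
   Context: For a prime $p$, $\mathbb{Z}_p$ denotes the finite field of integers modulo $p$ and $\mathbb{Z}_p^*$ its multiplicative group of units. A generalized arithmetic progression (GAP) of dimension $n$ in $\mathbb{Z}_p$, where $n$ is a positive integer, is a set of the form $S=\{a+x_1d_1+\dots+x_nd_n : x_i\in[0,L_i-1],\ 1\le i\le n\}$, where $a\in\mathbb{Z}_p$, $d_i\in\mathbb{Z}_p^*$, the $L_i$ are integers with $L_i\ge 2$ for all $1\le i\le n$, and $[0,L_i-1]$ denotes the set of integers from $0$ to $L_i-1$. A set is a generalized arithmetic progression if it is a GAP of some dimension $n\ge 1$; it is not required to be proper, i.e. to satisfy $|S|=\prod_{i=1}^n L_i$.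
   Formalization: The prime p is assumed to be different from 2: for p = 2, k = 1 one has t = 1 = p−1 and A_1 = {1}, but every generalized arithmetic progression in Z_2 is {0,1}, so the equivalence fails there. *)

theory Defs
  imports "HOL-Number_Theory.Number_Theory"
begin

text \<open>
  The field of integers modulo \<open>p\<close> is the library's \<^const>\<open>residue_ring\<close>, with carrier the
  integers \<open>{0..p - 1}\<close> and unit group \<^term>\<open>Units (residue_ring (int p))\<close>. In a progression the
  sum is formed in the integers and reduced modulo \<open>p\<close> once, which gives the same residue as
  computing in the ring. Different coefficient vectors \<open>x\<close> may give the same element, so
  progressions need not be proper.
\<close>

definition is_GAP_dim :: "nat \<Rightarrow> nat \<Rightarrow> int set \<Rightarrow> bool" where
  "is_GAP_dim p n S \<longleftrightarrow>
     (\<exists>a (d :: nat \<Rightarrow> int) (L :: nat \<Rightarrow> nat).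
        a \<in> carrier (residue_ring (int p)) \<and>
        (\<forall>i\<in>{1..n}. d i \<in> Units (residue_ring (int p)) \<and> 2 \<le> L i) \<and>
        S = {(a + (\<Sum>i=1..n. int (x i) * d i)) mod int p | x :: nat \<Rightarrow> nat.
               \<forall>i\<in>{1..n}. x i \<in> {0..L i - 1}})"

definition is_GAP :: "nat \<Rightarrow> int set \<Rightarrow> bool" where
  "is_GAP p S \<longleftrightarrow> (\<exists>n\<ge>1. is_GAP_dim p n S)"

definition kth_powers :: "nat \<Rightarrow> nat \<Rightarrow> int set" where
  "kth_powers p k =
     {x [^]\<^bsub>residue_ring (int p)\<^esub> k | x. x \<in> Units (residue_ring (int p))}"

end

theory Submission
  imports Defs "HOL-Computational_Algebra.Polynomial"
begin

text \<open>
  Write \<open>G\<close> for the group of \<open>k\<close>th powers, of order \<open>t\<close>. Of a progression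
  only its first difference \<open>d\<close> matters for the hard direction: splitting the range
  \<open>{0, \<dots>, L - 1}\<close> of the first coefficient as \<open>{0, 1} + {0, \<dots>, L - 2}\<close> shows that every
  progression is a union \<open>B \<union> (B + d)\<close> of two translates (\<open>GAP_eq_two_translates\<close>). So the hard direction follows once a subgroup of order
  \<open>t < p - 1\<close> of this form is shown to have \<open>t = 2\<close> or \<open>t = 4\<close>
  (\<open>subgroup_eq_two_translates\<close>).

  This is done by Stepanov's polynomial method, in the style of Hanson and Petridis. The polynomial
  \<open>F = (x + d)\<^sup>t\<^sup>+\<^sup>1 - x\<^sup>t\<^sup>+\<^sup>1 - d\<close> has degree \<open>t\<close> modulo \<open>p\<close>, with leading coefficient
  \<open>(t + 1) d\<close>. For \<open>b \<in> B\<close> both \<open>b\<close> and \<open>b + d\<close> lie in \<open>G\<close>, so their \<open>t\<close>th powers are \<open>1\<close>,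
  and \<open>b\<close> is a zero of \<open>F\<close> and of \<open>F'\<close>. Counting zeros gives \<open>2 |B| \<le> t\<close>, while
  \<open>G = B \<union> (B + d)\<close> gives \<open>t \<le> 2 |B|\<close>. Hence \<open>t = 2 |B|\<close>, the two translates are disjoint, and
  \<open>F\<close> is completely known: \<open>F \<equiv> (t + 1) d \<Prod>(x - b)\<^sup>2\<close>.

  If \<open>t > 2\<close>, then the sums of \<open>g\<close> and of \<open>g\<^sup>2\<close> over \<open>G\<close> vanish. Spelled out over the two
  translates this says \<open>\<Sum>b \<equiv> - t d / 4\<close> and \<open>\<Sum>b\<^sup>2 \<equiv> 0\<close>, with sums over \<open>B\<close>. These two power sums
  determine the third highest coefficient of \<open>\<Prod>(x - b)\<^sup>2\<close>, and comparing it with that of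
  \<open>F\<close> gives \<open>t (t - 4) \<equiv> 0\<close>, that is \<open>t = 4\<close>.

  Conversely, any two distinct residues form a progression; a group \<open>{1, h, -1, -h}\<close> is a parallelogram;
  and \<open>{1, \<dots>, p - 1}\<close> is an interval.

  Polynomials over the field with \<open>p\<close> elements are represented by integer polynomials \<open>F\<close>, with
  \<open>[:p:] dvd F\<close> expressing that \<open>F\<close> vanishes modulo \<open>p\<close>.
\<close>

section \<open>Double zeros of polynomials modulo a prime\<close>

text \<open>
  Over the field with \<open>p\<close> elements, a double zero \<open>b\<close> splits off a factor \<open>(x - b)\<^sup>2\<close>, which is
  invertible at the other points of \<open>B\<close>; so the quotient \<open>H\<close> still has double zeros there. Over
  the integers the two divisions by \<open>x - b\<close> leave a remainder that vanishes only modulo \<open>p\<close>.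
\<close>
lemma double_roots_mod_prime_zero:
  fixes p :: int and F :: "int poly"
  assumes "prime p" "finite B"
    and "\<And>b c. b \<in> B \<Longrightarrow> c \<in> B \<Longrightarrow> p dvd b - c \<Longrightarrow> b = c"
    and "\<And>b. b \<in> B \<Longrightarrow> p dvd poly F b"
    and "\<And>b. b \<in> B \<Longrightarrow> p dvd poly (pderiv F) b"
    and "degree F < 2 * card B"
  shows "[:p:] dvd F"
  using assms(2-)
proof (induction B arbitrary: F rule: finite_induct)
  case empty
  then show ?case by simp
next
  case (insert b B)
  define Q where "Q = synthetic_div F b"
  define H where "H = synthetic_div Q b"
  have F_eq: "F = [:-b, 1:] * Q + [:poly F b:]"
    unfolding Q_def by (rule synthetic_div_correct'[symmetric])
  have Q_eq: "Q = [:-b, 1:] * H + [:poly Q b:]"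
    unfolding H_def by (rule synthetic_div_correct'[symmetric])
  have "pderiv F = Q + [:-b, 1:] * pderiv Q"
    by (subst F_eq) (simp add: pderiv_mult pderiv_add pderiv_diff pderiv_smult pderiv_pCons)
  then have Qb: "poly (pderiv F) b = poly Q b"
    by simp
  have F_expand: "F = [:-b, 1:] ^ 2 * H + [:-b, 1:] * [:poly Q b:] + [:poly F b:]"
    by (subst F_eq, subst Q_eq) (simp only: power2_eq_square distrib_left mult.assoc)
  have rem: "[:p:] dvd [:-b, 1:] * [:poly Q b:] + [:poly F b:]"
    using insert.prems(2,3)[of b] Qb by (intro dvd_add dvd_mult) simp_all
  have "[:p:] dvd H"
  proof (cases "degree F < 2")
    case True
    then have "H = 0"
      by (simp add: H_def Q_def synthetic_div_eq_0_iff degree_synthetic_div)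
    then show ?thesis by simp
  next
    case False
    show ?thesis
    proof (rule insert.IH)
      show "b' = c" if "b' \<in> B" "c \<in> B" "p dvd b' - c" for b' c
        using insert.prems(1) that by blast
      show "degree H < 2 * card B"
        using insert.prems(4) insert.hyps False
        by (simp add: H_def Q_def degree_synthetic_div)
    next
      fix c assume c: "c \<in> B"
      then have ncb: "\<not> p dvd c - b"
        using insert.prems(1)[of c b] insert.hyps by auto
      have "poly F c = (c - b)^2 * poly H c + (c - b) * poly Q b + poly F b"
        by (subst F_expand) (simp add: algebra_simps)
      moreover have "p dvd poly F c" "p dvd poly Q b" "p dvd poly F b"
        using insert.prems(2,3) c Qb by (auto simp flip: Qb)
      ultimately have "p dvd (c - b)^2 * poly H c"
        by (metis dvd_add_left_iff dvd_mult)
      then show H: "p dvd poly H c"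
        using ncb \<open>prime p\<close> by (simp add: prime_dvd_mult_iff prime_dvd_power_iff)
      have "poly (pderiv F) c
            = (c - b)^2 * poly (pderiv H) c + 2 * (c - b) * poly H c + poly Q b"
        by (subst F_expand)
          (simp add: pderiv_mult pderiv_add pderiv_diff pderiv_smult pderiv_pCons power2_eq_square algebra_simps)
      moreover have "p dvd poly (pderiv F) c"
        using insert.prems(3) c by auto
      ultimately have "p dvd (c - b)^2 * poly (pderiv H) c"
        using H \<open>p dvd poly Q b\<close> by (metis dvd_add_left_iff dvd_mult)
      then show "p dvd poly (pderiv H) c"
        using ncb \<open>prime p\<close> by (simp add: prime_dvd_mult_iff prime_dvd_power_iff)
    qed
  qed
  then show ?case
    using rem by (subst F_expand) (simp only: add.assoc dvd_add dvd_mult)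
qed

text \<open>
  The first elementary symmetric functions in terms of power sums. The reversed factors
  \<open>1 - b x\<close> put them at the low end, where an induction does not have to keep track of the degree.
\<close>
lemma coeffs_prod_one_minus_linear:
  fixes B :: "'a :: comm_ring_1 set"
  assumes "finite B"
  defines "R \<equiv> \<Prod>b\<in>B. [:1, -b:]"
  shows "coeff R 0 = 1" "coeff R 1 = - (\<Sum>b\<in>B. b)"
    "2 * coeff R 2 = (\<Sum>b\<in>B. b)^2 - (\<Sum>b\<in>B. b^2)"
proof -
  have "coeff (\<Prod>b\<in>B. [:1, -b:]) 0 = 1 \<and> coeff (\<Prod>b\<in>B. [:1, -b:]) 1 = - (\<Sum>b\<in>B. b)
    \<and> 2 * coeff (\<Prod>b\<in>B. [:1, -b:]) 2 = (\<Sum>b\<in>B. b)^2 - (\<Sum>b\<in>B. b^2)"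
    using assms(1)
  proof (induction B rule: finite_induct)
    case (insert b B)
    let ?R = "\<Prod>b\<in>B. [:1, -b:]"
    have eq: "(\<Prod>b\<in>insert b B. [:1, -b:]) = ?R - pCons 0 (smult b ?R)"
      using insert.hyps by simp
    have "2 * coeff (\<Prod>b\<in>insert b B. [:1, -b:]) 2 = 2 * coeff ?R 2 - 2 * b * coeff ?R 1"
      unfolding eq by (simp add: numeral_2_eq_2 algebra_simps)
    with insert show ?case
      unfolding eq by (simp add: algebra_simps power2_eq_square)
  qed auto
  then show "coeff R 0 = 1" "coeff R 1 = - (\<Sum>b\<in>B. b)"
    "2 * coeff R 2 = (\<Sum>b\<in>B. b)^2 - (\<Sum>b\<in>B. b^2)"
    by (simp_all add: R_def)
qed

text \<open>
  The third highest coefficient is the second elementary symmetric function of the multiset that contains each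
  \<open>b\<close> twice.
\<close>
lemma monic_square_prod_linear:
  fixes B :: "int set"
  assumes "finite B"
  defines "Q \<equiv> (\<Prod>b\<in>B. [:-b, 1:]) ^ 2"
  shows "degree Q = 2 * card B" "lead_coeff Q = 1"
    "card B > 0 \<Longrightarrow> coeff Q (2 * card B - 2) = 2 * (\<Sum>b\<in>B. b)^2 - (\<Sum>b\<in>B. b^2)"
proof -
  have reflect: "reflect_poly [:-b, 1:] = [:1, -b:]" for b :: int
    by (cases "b = 0") (simp_all add: reflect_poly_pCons reflect_poly_pCons')
  define R where "R = (\<Prod>b\<in>B. [:1, -b:])"
  have deg: "degree (\<Prod>b\<in>B. [:-b, 1:]) = card B"
    by (subst degree_prod_eq_sum_degree) (auto simp: assms)
  then show "degree Q = 2 * card B"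
    unfolding Q_def by (subst degree_power_eq) (auto simp: assms(1))
  show "lead_coeff Q = 1"
    unfolding Q_def lead_coeff_power lead_coeff_prod by simp
  assume "card B > 0"
  have "reflect_poly Q = R ^ 2"
    by (simp add: Q_def R_def reflect_poly_power reflect_poly_prod reflect)
  then have "coeff Q (2 * card B - 2) = coeff (R ^ 2) 2"
    using \<open>degree Q = _\<close> \<open>card B > 0\<close> coeff_reflect_poly[of Q 2] by (simp split: if_splits)
  also have "\<dots> = 2 * coeff R 0 * coeff R 2 + coeff R 1 ^ 2"
    by (simp add: power2_eq_square coeff_mult numeral_2_eq_2 algebra_simps)
  also have "\<dots> = 2 * (\<Sum>b\<in>B. b)^2 - (\<Sum>b\<in>B. b^2)"
    using coeffs_prod_one_minus_linear[OF assms(1)] unfolding R_def by simp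
  finally show "coeff Q (2 * card B - 2) = 2 * (\<Sum>b\<in>B. b)^2 - (\<Sum>b\<in>B. b^2)" .
qed

section \<open>Subgroups that are a union of two translates\<close>

text \<open>
  Multiplication by \<open>h\<close> permutes \<open>G\<close>, so it fixes the sum modulo \<open>p\<close> and also multiplies it by
  \<open>h ^ j\<close>.
\<close>
lemma power_sum_mod_subgroup:
  fixes p :: int and G :: "int set"
  assumes "prime p" "G \<subseteq> {1..<p}"
    and closed: "\<And>g h. g \<in> G \<Longrightarrow> h \<in> G \<Longrightarrow> g * h mod p \<in> G"
    and h: "h \<in> G" "\<not> [h ^ j = 1] (mod p)"
  shows "p dvd (\<Sum>g\<in>G. g ^ j)"
proof -
  have fin: "finite G"
    using assms(2) finite_subset by blast
  have "\<not> p dvd h"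
    using h(1) assms(2) zdvd_not_zless[of h p] by auto
  have inj: "inj_on (\<lambda>g. h * g mod p) G"
  proof (rule inj_onI)
    fix x y assume xy: "x \<in> G" "y \<in> G" "h * x mod p = h * y mod p"
    then have "[x = y] (mod p)"
      using \<open>prime p\<close> \<open>\<not> p dvd h\<close>
      by (metis cong_def cong_mult_lcancel coprime_commute prime_imp_coprime)
    moreover have "x \<in> {1..<p}" "y \<in> {1..<p}"
      using xy assms(2) by auto
    ultimately show "x = y"
      by (simp add: cong_def)
  qed
  moreover have "(\<lambda>g. h * g mod p) ` G \<subseteq> G"
    using closed h(1) by auto
  ultimately have img: "(\<lambda>g. h * g mod p) ` G = G"
    using fin by (simp add: endo_inj_surj)
  have "(\<Sum>g\<in>G. g ^ j) = (\<Sum>g\<in>G. (h * g mod p) ^ j)"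
    using sum.reindex[OF inj, of "\<lambda>g. g ^ j"] by (simp add: img)
  also have "[\<dots> = (\<Sum>g\<in>G. (h * g) ^ j)] (mod p)"
    by (intro cong_sum cong_pow) simp
  also have "(\<Sum>g\<in>G. (h * g) ^ j) = h ^ j * (\<Sum>g\<in>G. g ^ j)"
    by (simp add: power_mult_distrib sum_distrib_left)
  finally have "p dvd (h ^ j - 1) * (\<Sum>g\<in>G. g ^ j)"
    by (simp add: cong_iff_dvd_diff algebra_simps dvd_diff_commute)
  then show ?thesis
    using h(2) \<open>prime p\<close> by (simp add: prime_dvd_mult_iff cong_iff_dvd_diff)
qed

lemma six_times_choose_3: "6 * int (n choose 3) = int n * (int n - 1) * (int n - 2)"
proof -
  have choose_2: "2 * int (n choose 2) = int n * (int n - 1)" for n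
    by (induction n) (simp_all add: numeral_2_eq_2 algebra_simps)
  show ?thesis
  proof (induction n)
    case (Suc n)
    have "Suc n choose 3 = (n choose 2) + (n choose 3)"
      by (simp add: numeral_3_eq_3 numeral_2_eq_2)
    then show ?case
      using Suc.IH choose_2[of n] by (simp add: algebra_simps)
  qed (simp add: numeral_3_eq_3)
qed

text \<open>
  The double zeros of \<open>F\<close> force \<open>F \<equiv> (t + 1) d \<Prod>(x - b)\<^sup>2\<close>, and the vanishing of the first two
  power sums of \<open>G\<close> makes the coefficients of \<open>x\<^sup>t\<^sup>-\<^sup>2\<close> agree only for \<open>t = 4\<close>. The bound
  \<open>t + 1 < p\<close> keeps the leading coefficient \<open>(t + 1) d\<close> from vanishing modulo \<open>p\<close>; the full unit
  group, where \<open>t + 1 = p\<close>, is a union of two translates for every odd \<open>p\<close>.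
\<close>
lemma subgroup_eq_two_translates:
  fixes p d :: int and G B :: "int set" and t :: nat
  assumes p: "prime p" and G: "G \<subseteq> {1..<p}"
    and closed: "\<And>g h. g \<in> G \<Longrightarrow> h \<in> G \<Longrightarrow> g * h mod p \<in> G"
    and pow: "\<And>g. g \<in> G \<Longrightarrow> [g ^ t = 1] (mod p)"
    and t: "card G = t" "0 < t" "int t + 1 < p"
    and d: "\<not> p dvd d"
    and GB: "G = B \<union> (\<lambda>b. (b + d) mod p) ` B"
  shows "t = 2 \<or> t = 4"
proof -
  define T where "T = (\<lambda>b. (b + d) mod p) ` B"
  have GBT: "G = B \<union> T"
    using GB by (simp add: T_def)
  have finG: "finite G"
    using G finite_subset by blast
  have "B \<subseteq> G" and finB: "finite B"
    using GBT finG by auto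
  have distinct: "b = c" if "b \<in> B" "c \<in> B" "p dvd b - c" for b c
  proof -
    have "b \<in> {1..<p}" "c \<in> {1..<p}"
      using that \<open>B \<subseteq> G\<close> G by auto
    then show ?thesis
      using that(3) by (simp add: mod_eq_dvd_iff[symmetric])
  qed
  have npt: "\<not> p dvd int k" if "0 < k" "k \<le> t + 1" for k
    using that t(3) zdvd_not_zless[of "int k" p] by auto

  define m where "m = int (t + 1)"
  define F where "F = [:d, 1:] ^ (t + 1) - monom 1 (t + 1) - [:d:]"
  have coeff_F: "coeff F i = int ((t + 1) choose i) * d ^ (t + 1 - i)" if "0 < i" "i \<le> t" for i
    using that by (simp add: F_def coeff_linear_poly_power coeff_pCons del: power_Suc binomial_Suc_Suc split: nat.splits)
  have coeff_F_0: "coeff F i = 0" if "i > t" for i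
  proof (cases "i = t + 1")
    case True
    then show ?thesis
      by (simp add: F_def coeff_linear_poly_power coeff_pCons del: power_Suc)
  next
    case False
    then have "coeff ([:d, 1:] ^ (t + 1)) i = 0"
      using that by (intro coeff_eq_0) (simp add: degree_linear_power del: power_Suc)
    then show ?thesis
      using that False by (auto simp: F_def coeff_pCons simp del: power_Suc split: nat.splits)
  qed
  have degF: "degree F \<le> t"
    using coeff_F_0 by (intro degree_le) auto
  have pow_B: "p dvd b ^ t - 1" "p dvd (b + d) ^ t - 1" if "b \<in> B" for b
  proof -
    show "p dvd b ^ t - 1"
      using pow that \<open>B \<subseteq> G\<close> by (auto simp: cong_iff_dvd_diff)
    have "[((b + d) mod p) ^ t = 1] (mod p)"
      using pow that GB by blast
    then have "[(b + d) ^ t = 1] (mod p)"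
      by (simp add: cong_def power_mod)
    then show "p dvd (b + d) ^ t - 1"
      by (simp add: cong_iff_dvd_diff)
  qed
  have F_root: "p dvd poly F b" if "b \<in> B" for b
  proof -
    have "poly F b = (b + d) * ((b + d) ^ t - 1) - b * (b ^ t - 1)"
      by (simp add: F_def poly_monom algebra_simps)
    then show ?thesis
      using pow_B[OF that] by (metis dvd_diff dvd_mult)
  qed
  have F'_root: "p dvd poly (pderiv F) b" if "b \<in> B" for b
  proof -
    have "poly (pderiv F) b = m * ((b + d) ^ t - 1) - m * (b ^ t - 1)"
      by (simp add: F_def m_def pderiv_diff pderiv_add pderiv_power_Suc pderiv_monom pderiv_pCons poly_monom
          algebra_simps del: power_Suc)
    then show ?thesis
      using pow_B[OF that] by (metis dvd_diff dvd_mult)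
  qed
  have coeff_F_t: "coeff F t = m * d"
    using coeff_F[of t] t(2) by (simp add: m_def)
  \<comment> \<open>\<open>F\<close> cannot have more than \<open>t\<close> zeros with multiplicity, as it does not vanish modulo \<open>p\<close>.\<close>
  have "2 * card B \<le> t"
  proof (rule ccontr)
    assume "\<not> 2 * card B \<le> t"
    then have "[:p:] dvd F"
      using degF by (intro double_roots_mod_prime_zero[OF p finB distinct F_root F'_root]) auto
    then have "p dvd m * d"
      using coeff_F_t by (metis const_poly_dvd_iff)
    then show False
      using d p npt[of "t + 1"] by (simp add: prime_dvd_mult_iff m_def)
  qed
  moreover have cardT: "card T \<le> card B"
    using finB by (simp add: T_def card_image_le)
  moreover have cardG: "t \<le> card B + card T"
    using t(1) GBT card_Un_le by metis
  ultimately have t2: "t = 2 * card B" and cT: "card T = card B"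
    by auto
  have disj: "B \<inter> T = {}"
    using card_Un_Int[of B T] finB t(1) t2 cT GBT by (auto simp: T_def)
  have injT: "inj_on (\<lambda>b. (b + d) mod p) B"
    using cT finB by (simp add: T_def eq_card_imp_inj_on)
  define S1 S2 s where "S1 = (\<Sum>b\<in>B. b)" and "S2 = (\<Sum>b\<in>B. b^2)" and "s = int (card B)"
  have sum_G: "[(\<Sum>g\<in>G. g ^ j) = (\<Sum>b\<in>B. b ^ j) + (\<Sum>b\<in>B. (b + d) ^ j)] (mod p)" for j
  proof -
    have "(\<Sum>g\<in>G. g ^ j) = (\<Sum>b\<in>B. b ^ j) + (\<Sum>g\<in>T. g ^ j)"
      unfolding GBT using finB disj by (intro sum.union_disjoint) (auto simp: T_def)
    also have "(\<Sum>g\<in>T. g ^ j) = (\<Sum>b\<in>B. ((b + d) mod p) ^ j)"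
      unfolding T_def by (simp add: sum.reindex[OF injT])
    also have "[(\<Sum>b\<in>B. b ^ j) + \<dots> = (\<Sum>b\<in>B. b ^ j) + (\<Sum>b\<in>B. (b + d) ^ j)] (mod p)"
      by (intro cong_add cong_refl cong_sum cong_pow) simp
    finally show ?thesis .
  qed
  show ?thesis
  proof (rule disjCI)
    assume "t \<noteq> 4"
    show "t = 2"
    proof (rule ccontr)
      assume "t \<noteq> 2"
      then have "t \<ge> 4"
        using t2 t(2) by presburger
      \<comment> \<open>Only two residues have square \<open>1\<close>, so a group of order at least \<open>4\<close> contains \<open>h\<close>
        with \<open>h\<^sup>2 \<noteq> 1\<close>, and then also \<open>h \<noteq> 1\<close>: both power sums vanish.\<close>
      obtain h where h: "h \<in> G" "\<not> [h ^ 2 = 1] (mod p)"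
      proof (rule ccontr)
        assume "\<not> thesis"
        then have sq: "[h ^ 2 = 1] (mod p)" if "h \<in> G" for h
          using that \<open>\<And>h. h \<in> G \<Longrightarrow> \<not> [h ^ 2 = 1] (mod p) \<Longrightarrow> thesis\<close> by blast
        have "G \<subseteq> {1, p - 1}"
        proof
          fix h assume hG: "h \<in> G"
          have "p dvd (h - 1) * (h + 1)"
            using sq[OF hG] by (simp add: cong_iff_dvd_diff power2_eq_square algebra_simps)
          then have "p dvd h - 1 \<or> p dvd h + 1"
            using p prime_dvd_mult_iff by blast
          moreover have "1 \<le> h" "h < p"
            using hG G by auto
          ultimately have "h - 1 = 0 \<or> h + 1 = p"
            using zdvd_not_zless[of "h - 1" p] zdvd_imp_le[of p "h + 1"] by force
          then show "h \<in> {1, p - 1}"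
            by auto
        qed
        then have "card G \<le> card {1, p - 1}"
          by (intro card_mono) auto
        then show False
          using t(1) \<open>t \<ge> 4\<close> by (simp add: card_insert_if split: if_splits)
      qed
      have "\<not> [h ^ 1 = 1] (mod p)"
        using h(2) cong_pow[of h 1 p 2] by auto
      then have sum1: "p dvd (\<Sum>g\<in>G. g ^ 1)"
        using power_sum_mod_subgroup[OF p G closed h(1)] by blast
      have sum2: "p dvd (\<Sum>g\<in>G. g ^ 2)"
        using power_sum_mod_subgroup[OF p G closed h] by blast
      have "(\<Sum>b\<in>B. b ^ 1) + (\<Sum>b\<in>B. (b + d) ^ 1) = 2 * S1 + s * d"
        by (simp add: S1_def s_def sum.distrib)
      then have rel1: "p dvd 2 * S1 + s * d"
        using sum1 sum_G[of 1] by (metis cong_dvd_iff)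
      have "(\<Sum>b\<in>B. b ^ 2) + (\<Sum>b\<in>B. (b + d) ^ 2) = 2 * S2 + 2 * d * S1 + s * d^2"
        by (simp add: S1_def S2_def s_def sum.distrib power2_sum sum_distrib_left algebra_simps)
      then have rel2: "p dvd 2 * S2 + 2 * d * S1 + s * d^2"
        using sum2 sum_G[of 2] by (metis cong_dvd_iff)

      \<comment> \<open>Subtracting \<open>m d Q\<close> removes the leading term of \<open>F\<close> and keeps all double zeros, so the
        difference \<open>W\<close> has too many zeros for its degree and vanishes modulo \<open>p\<close>.\<close>
      define Q where "Q = (\<Prod>b\<in>B. [:-b, 1:]) ^ 2"
      define W where "W = F - smult (m * d) Q"
      have degQ: "degree Q = t" and leadQ: "coeff Q t = 1"
        using monic_square_prod_linear(1,2)[OF finB] t2 by (auto simp: Q_def)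
      have coeffQ: "coeff Q (t - 2) = 2 * S1^2 - S2"
        using monic_square_prod_linear(3)[OF finB] t2 t(2) by (auto simp: Q_def S1_def S2_def)
      have degW: "degree W < t"
      proof (rule degree_lessI)
        show "\<forall>k\<ge>t. coeff W k = 0"
        proof (intro allI impI)
          fix k assume "t \<le> k"
          then show "coeff W k = 0"
            by (cases "k = t") (simp_all add: W_def coeff_F_0 coeff_F_t leadQ coeff_eq_0 degQ)
        qed
      qed (use t in simp)
      have Q_root: "poly Q b = 0" "poly (pderiv Q) b = 0" if "b \<in> B" for b
      proof -
        have "poly (\<Prod>b\<in>B. [:-b, 1:]) b = 0"
          using that finB by (auto simp: poly_prod)
        then show "poly Q b = 0" "poly (pderiv Q) b = 0"
          by (simp_all add: Q_def power2_eq_square pderiv_mult)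
      qed
      have "[:p:] dvd W"
      proof (rule double_roots_mod_prime_zero[OF p finB distinct])
        show "p dvd poly W b" if "b \<in> B" for b
          using F_root[OF that] Q_root[OF that] by (simp add: W_def)
        show "p dvd poly (pderiv W) b" if "b \<in> B" for b
          using F'_root[OF that] Q_root[OF that] by (simp add: W_def pderiv_diff pderiv_smult)
        show "degree W < 2 * card B"
          using degW t2 by simp
      qed
      then have dvdW: "p dvd coeff W (t - 2)"
        by (simp add: const_poly_dvd_iff)
      define C where "C = int ((t + 1) choose 3)"
      have "t + 1 choose (t - 2) = t + 1 choose 3"
        using binomial_symmetric[of 3 "t + 1"] \<open>t \<ge> 4\<close> by (simp add: numeral_eq_Suc)
      then have coeffW: "coeff W (t - 2) = C * d^3 - m * d * (2 * S1^2 - S2)"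
        using coeff_F[of "t - 2"] \<open>t \<ge> 4\<close> coeffQ
        by (simp add: W_def C_def Suc_diff_le numeral_3_eq_3 numeral_2_eq_2)
      have C6: "6 * C = m * (m - 1) * (m - 2)"
        using six_times_choose_3[of "t + 1"] by (simp add: C_def m_def)
      have ms: "m = 2 * s + 1"
        using t2 by (simp add: m_def s_def)
      \<comment> \<open>Eliminates \<open>S1\<close> and \<open>S2\<close> from the coefficient of \<open>W\<close> by means of the two power sum
        relations. The factor 24 clears the denominators, 6 of \<open>C\<close> and 4 of \<open>S1\<^sup>2 \<equiv> s\<^sup>2 d\<^sup>2 / 4\<close>.\<close>
      have "2 * m * s * (2 * s - 4) * d^3 = 24 * (C * d^3 - m * d * (2 * S1^2 - S2))
          + 12 * m * d * (2 * S1 - s * d) * (2 * S1 + s * d)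
          - 12 * m * d * (2 * S2 + 2 * d * S1 + s * d^2) + 12 * m * d^2 * (2 * S1 + s * d)"
      proof -
        have "24 * C = 4 * (m * (m - 1) * (m - 2))"
          using C6 by simp
        then have "24 * (C * d^3) = 4 * (m * (m - 1) * (m - 2)) * d^3"
          by (metis mult.assoc)
        then show ?thesis
          by (simp add: ms algebra_simps power2_eq_square power3_eq_cube)
      qed
      moreover have "p dvd \<dots>"
        by (rule dvd_add[OF dvd_diff[OF dvd_add[OF dvd_mult[OF dvdW[unfolded coeffW]]
                dvd_mult[OF rel1]] dvd_mult[OF rel2]] dvd_mult[OF rel1]])
      ultimately have "p dvd m * (2 * s) * (2 * s - 4) * d^3"
        by (simp add: mult_ac)
      moreover have "\<not> p dvd m" "\<not> p dvd 2 * s" "\<not> p dvd d ^ 3"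
        using npt[of "t + 1"] npt[of t] t2 t(2) d p
        by (auto simp: m_def s_def prime_dvd_power_iff)
      ultimately have "p dvd 2 * s - 4"
        using p by (metis prime_dvd_mult_iff)
      moreover have "2 * s - 4 = int (t - 4)"
        using t2 \<open>t \<ge> 4\<close> by (simp add: s_def of_nat_diff)
      moreover have "\<not> p dvd int (t - 4)"
        using \<open>t \<ge> 4\<close> \<open>t \<noteq> 4\<close> by (intro npt) auto
      ultimately show False
        by simp
    qed
  qed
qed

section \<open>The group of \<open>k\<close>th powers\<close>

lemma residue_ring_prime:
  assumes "prime p"
  shows Units_residue_ring_prime: "Units (residue_ring (int p)) = {1..<int p}"
    and carrier_residue_ring_prime: "carrier (residue_ring (int p)) = {0..<int p}"
    and pow_residue_ring_prime: "x \<in> {1..<int p} \<Longrightarrow> x [^]\<^bsub>residue_ring (int p)\<^esub> (k :: nat) = x ^ k mod int p"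
proof -
  interpret R: residues_prime p "residue_ring (int p)"
    by (simp add: residues_prime_def assms)
  show "Units (residue_ring (int p)) = {1..<int p}"
    unfolding R.res_prime_units_eq by auto
  show "carrier (residue_ring (int p)) = {0..<int p}"
    unfolding R.res_carrier_eq by auto
  show "x [^]\<^bsub>residue_ring (int p)\<^esub> k = x ^ k mod int p" if "x \<in> {1..<int p}"
    using R.pow_cong[of x k] that by simp
qed

lemma kth_powers_eq_image:
  assumes "prime p"
  shows "kth_powers p k = (\<lambda>x. x ^ k mod int p) ` {1..<int p}"
  unfolding kth_powers_def Units_residue_ring_prime[OF assms] Setcompr_eq_image Collect_mem_eq
  by (intro image_cong refl pow_residue_ring_prime[OF assms])

lemma kth_powers_closed:
  assumes "prime p" "g \<in> kth_powers p k" "h \<in> kth_powers p k"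
  shows "g * h mod int p \<in> kth_powers p k"
proof -
  obtain x y where x: "x \<in> {1..<int p}" "g = x ^ k mod int p"
    and y: "y \<in> {1..<int p}" "h = y ^ k mod int p"
    using assms by (auto simp: kth_powers_eq_image)
  have "\<not> int p dvd x * y"
    using x y assms(1) zdvd_not_zless[of x "int p"] zdvd_not_zless[of y "int p"]
    by (auto simp: prime_dvd_mult_iff)
  then have "x * y mod int p \<in> {1..<int p}"
    using prime_gt_0_nat[OF assms(1)] pos_mod_sign[of "int p" "x * y"]
    by (auto simp: dvd_eq_mod_eq_0 simp del: pos_mod_sign)
  moreover have "g * h mod int p = (x * y mod int p) ^ k mod int p"
    by (simp add: x y power_mult_distrib mod_mult_eq power_mod)
  ultimately show ?thesis
    using assms(1) by (auto simp: kth_powers_eq_image)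
qed

lemma kth_powers_subset:
  assumes "prime p"
  shows "kth_powers p k \<subseteq> {1..<int p}"
proof -
  have "x ^ k mod int p \<in> {1..<int p}" if "x \<in> {1..<int p}" for x
  proof -
    have "\<not> int p dvd x ^ k"
      using that assms zdvd_not_zless[of x "int p"] prime_dvd_power[of "int p" x k] by auto
    then show ?thesis
      using prime_gt_0_nat[OF assms] pos_mod_sign[of "int p" "x ^ k"]
      by (auto simp: dvd_eq_mod_eq_0 simp del: pos_mod_sign)
  qed
  then show ?thesis
    using assms by (auto simp: kth_powers_eq_image)
qed

text \<open>
  For a primitive root \<open>g\<close> the powers of \<open>h = g ^ k\<close> exhaust the \<open>k\<close>th powers. They are distinct up
  to exponent \<open>t\<close>, because the exponents \<open>k * j\<close> of \<open>g\<close> then stay below \<open>p - 1\<close>.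
\<close>
lemma kth_powers_cyclic:
  assumes p: "prime p" and kt: "k * t = p - 1"
  obtains h where "bij_betw (\<lambda>j. h ^ j mod int p) {..<t} (kth_powers p k)" "[h ^ t = 1] (mod int p)"
proof -
  have p1: "p > 1"
    using p prime_gt_1_nat by blast
  have "k > 0" "t > 0"
    using kt p1 by (auto intro!: Nat.gr0I)
  obtain g where g: "residue_primroot p g"
    using prime_primitive_root_exists[OF p1] p by blast
  have gbij: "bij_betw (\<lambda>i. g ^ i mod p) {..<p - 1} {0<..<p}"
    using residue_primroot_is_generator[OF p1 g] p by (simp add: totient_prime totatives_prime)
  have g1: "[g ^ (p - 1) = 1] (mod p)"
    using g euler_theorem[of g p] p by (simp add: residue_primroot_def totient_prime coprime_commute)
  define h where "h = int (g ^ k)"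
  have h_pow: "h ^ j mod int p = int (g ^ (k * j) mod p)" for j
    by (simp add: h_def power_mult zmod_int)
  have h1: "[h ^ t = 1] (mod int p)"
    using g1 p1 h_pow[of t] unfolding kt by (simp add: cong_def)
  have "inj_on (\<lambda>j. h ^ j mod int p) {..<t}"
  proof (rule inj_onI)
    fix i j assume ij: "i \<in> {..<t}" "j \<in> {..<t}" "h ^ i mod int p = h ^ j mod int p"
    then have "k * i < k * t" "k * j < k * t"
      using \<open>k > 0\<close> by simp_all
    then have "k * i < p - 1" "k * j < p - 1"
      unfolding kt .
    moreover have "g ^ (k * i) mod p = g ^ (k * j) mod p"
      using ij(3) unfolding h_pow by simp
    ultimately have "k * i = k * j"
      using inj_onD[OF bij_betw_imp_inj_on[OF gbij], of "k * i" "k * j"] by simp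
    then show "i = j"
      using \<open>k > 0\<close> by simp
  qed
  moreover have "(\<lambda>j. h ^ j mod int p) ` {..<t} = kth_powers p k"
  proof (intro equalityI subsetI)
    fix y assume "y \<in> (\<lambda>j. h ^ j mod int p) ` {..<t}"
    then obtain j where j: "j < t" "y = h ^ j mod int p"
      by auto
    then have "j \<in> {..<p - 1}"
      using mult_le_mono1[of 1 k t] \<open>k > 0\<close> unfolding kt by simp
    then have "g ^ j mod p \<in> {0<..<p}"
      using bij_betwE[OF gbij] by blast
    then have "int (g ^ j mod p) \<in> {1..<int p}"
      by auto
    moreover have "y = int (g ^ j mod p) ^ k mod int p"
      unfolding j(2) h_def of_nat_mod of_nat_power power_mod
      by (simp only: power_mod power_mult[symmetric] mult.commute)
    ultimately show "y \<in> kth_powers p k"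
      using p by (auto simp: kth_powers_eq_image)
  next
    fix y assume "y \<in> kth_powers p k"
    then obtain x where x: "x \<in> {1..<int p}" "y = x ^ k mod int p"
      using p by (auto simp: kth_powers_eq_image)
    then have "nat x \<in> {0<..<p}"
      by auto
    then obtain i where "nat x = g ^ i mod p"
      using bij_betw_imp_surj_on[OF gbij] by blast
    moreover have "x = int (nat x)"
      using x by simp
    ultimately have "x = int (g ^ i mod p)"
      by simp
    then have y: "y = h ^ i mod int p"
      unfolding x(2) h_def of_nat_mod of_nat_power power_mod
      by (simp only: power_mod power_mult[symmetric] mult.commute)
    have "h ^ i = (h ^ t) ^ (i div t) * h ^ (i mod t)"
      unfolding power_mult[symmetric] power_add[symmetric] by simp
    also have "[\<dots> = 1 ^ (i div t) * h ^ (i mod t)] (mod int p)"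
      by (intro cong_mult cong_pow h1 cong_refl)
    finally have "y = h ^ (i mod t) mod int p"
      by (simp add: y cong_def)
    then show "y \<in> (\<lambda>j. h ^ j mod int p) ` {..<t}"
      using \<open>t > 0\<close> by auto
  qed
  ultimately show ?thesis
    using that h1 by (simp add: bij_betw_def)
qed

section \<open>Generalized arithmetic progressions\<close>

text \<open>
  \<open>B\<close> is the subprogression whose first coefficient stops one short of its maximum \<open>L 1 - 1\<close>. A step
  by \<open>d = d 1\<close> supplies the elements in which it attains the maximum, which is at least \<open>1\<close>.
\<close>
lemma GAP_eq_two_translates:
  assumes "prime p" "is_GAP p S"
  obtains d B where "\<not> int p dvd d" "S = B \<union> (\<lambda>b. (b + d) mod int p) ` B"
proof -
  obtain n where n: "n \<ge> 1" and dim: "is_GAP_dim p n S"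
    using assms(2) unfolding is_GAP_def by blast
  obtain a d L where
    adL: "a \<in> carrier (residue_ring (int p)) \<and>
        (\<forall>i\<in>{1..n}. d i \<in> Units (residue_ring (int p)) \<and> 2 \<le> L i) \<and>
        S = {(a + (\<Sum>i=1..n. int (x i) * d i)) mod int p | x :: nat \<Rightarrow> nat.
               \<forall>i\<in>{1..n}. x i \<in> {0..L i - 1}}"
    using dim unfolding is_GAP_dim_def by (elim exE)
  define v where "v = (\<lambda>x :: nat \<Rightarrow> nat. (a + (\<Sum>i=1..n. int (x i) * d i)) mod int p)"
  define X where "X = {x. \<forall>i\<in>{1..n}. x i \<in> {0..L i - 1}}"
  define B where "B = v ` {x \<in> X. x 1 \<le> L 1 - 2}"
  have L1: "2 \<le> L 1" and d1: "d 1 \<in> Units (residue_ring (int p))"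
    using adL n by auto
  have S_eq: "S = v ` X"
    unfolding v_def X_def image_def using adL by blast
  have v_step: "v (x(1 := Suc (x 1))) = (v x + d 1) mod int p" for x
  proof -
    have "(\<Sum>i=1..n. int ((x(1 := Suc (x 1))) i) * d i) = (\<Sum>i=1..n. int (x i) * d i) + d 1"
      using n by (simp add: sum.atLeast_Suc_atMost algebra_simps)
    then show ?thesis
      by (simp add: v_def mod_add_left_eq add.assoc)
  qed
  have "S = B \<union> (\<lambda>b. (b + d 1) mod int p) ` B"
  proof (intro equalityI subsetI)
    fix y assume "y \<in> S"
    then obtain x where x: "x \<in> X" "y = v x"
      using S_eq by auto
    show "y \<in> B \<union> (\<lambda>b. (b + d 1) mod int p) ` B"
    proof (cases "x 1 \<le> L 1 - 2")
      case True
      then show ?thesis using x by (auto simp: B_def)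
    next
      case False
      define x' where "x' = x(1 := x 1 - 1)"
      have "x 1 \<le> L 1 - 1"
        using x n by (auto simp: X_def)
      then have "x' \<in> {x \<in> X. x 1 \<le> L 1 - 2}"
        using x(1) by (auto simp: x'_def X_def)
      moreover have "x = x'(1 := Suc (x' 1))"
        using False by (auto simp: x'_def)
      then have "y = (v x' + d 1) mod int p"
        using v_step[of x'] x(2) by simp
      ultimately show ?thesis
        by (auto simp: B_def)
    qed
  next
    fix y assume "y \<in> B \<union> (\<lambda>b. (b + d 1) mod int p) ` B"
    then obtain x where x: "x \<in> X" "x 1 \<le> L 1 - 2" "y = v x \<or> y = (v x + d 1) mod int p"
      by (auto simp: B_def)
    have "x(1 := Suc (x 1)) \<in> X"
      using x L1 by (auto simp: X_def)
    then show "y \<in> S"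
      using x v_step[of x] unfolding S_eq by (auto simp del: fun_upd_apply intro: rev_image_eqI)
  qed
  moreover have "\<not> int p dvd d 1"
    using d1 zdvd_not_zless[of "d 1" "int p"] unfolding Units_residue_ring_prime[OF assms(1)] by auto
  ultimately show ?thesis
    using that by blast
qed

lemma mod_in_Units_residue_ring:
  assumes "prime p" "\<not> int p dvd d"
  shows "d mod int p \<in> Units (residue_ring (int p))"
proof -
  have "d mod int p \<noteq> 0"
    using assms(2) by (simp add: dvd_eq_mod_eq_0)
  moreover have "0 \<le> d mod int p" "d mod int p < int p"
    using prime_gt_0_nat[OF assms(1)] by simp_all
  ultimately show ?thesis
    unfolding Units_residue_ring_prime[OF assms(1)] by simp
qed

lemma is_GAP_arithmetic_progression:
  assumes "prime p" "a \<in> {0..<int p}" "\<not> int p dvd d" "2 \<le> L"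
  shows "is_GAP p ((\<lambda>x. (a + int x * d) mod int p) ` {..<L})"
proof -
  have *: "(a + int x * (d mod int p)) mod int p = (a + int x * d) mod int p" for x
    by (rule mod_add_cong[OF refl mod_mult_right_eq])
  have "(\<lambda>x. (a + int x * d) mod int p) ` {..<L} =
     {(a + (\<Sum>i=1..1. int (x i) * (d mod int p))) mod int p | x :: nat \<Rightarrow> nat.
               \<forall>i\<in>{1..1}. x i \<in> {0..L - 1}}" (is "?A = ?B")
  proof (intro equalityI subsetI)
    fix y assume "y \<in> ?A"
    then obtain x where "x < L" "y = (a + int x * d) mod int p"
      by auto
    then show "y \<in> ?B"
      by (intro CollectI exI[of _ "\<lambda>_. x"]) (simp add: *)
  next
    fix y assume "y \<in> ?B"
    then obtain x :: "nat \<Rightarrow> nat" where "x 1 \<le> L - 1" "y = (a + int (x 1) * d) mod int p"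
      unfolding atLeastAtMost_singleton by (auto simp: *)
    then show "y \<in> ?A"
      using assms(4) by (intro image_eqI[of _ _ "x 1"]) simp_all
  qed
  then have "is_GAP_dim p 1 ?A"
    unfolding is_GAP_dim_def
    using assms(2,4) mod_in_Units_residue_ring[OF assms(1,3)]
    by (intro exI[of _ a] exI[of _ "\<lambda>_. d mod int p"] exI[of _ "\<lambda>_. L"] conjI ballI)
      (simp_all only: carrier_residue_ring_prime[OF assms(1)] simp_thms)
  then show ?thesis
    unfolding is_GAP_def by blast
qed

lemma is_GAP_parallelogram:
  assumes "prime p" "a \<in> {0..<int p}" "\<not> int p dvd d" "\<not> int p dvd e"
  shows "is_GAP p {a, (a + d) mod int p, (a + e) mod int p, (a + d + e) mod int p}"
proof -
  define D where "D = (\<lambda>i :: nat. (if i = 1 then d else e) mod int p)"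
  have D: "D i \<in> Units (residue_ring (int p))" for i
    using mod_in_Units_residue_ring[OF assms(1)] assms(3,4) by (simp add: D_def)
  define v where "v = (\<lambda>x :: nat \<Rightarrow> nat. (a + (\<Sum>i=1..2. int (x i) * D i)) mod int p)"
  have v: "v x = (a + int (x 1) * d + int (x 2) * e) mod int p" for x
  proof -
    have "(\<Sum>i=1..2. int (x i) * D i) = int (x 1) * D 1 + int (x 2) * D 2"
      by (simp add: numeral_2_eq_2)
    moreover have "[a + (int (x 1) * D 1 + int (x 2) * D 2) = a + (int (x 1) * d + int (x 2) * e)] (mod int p)"
      by (intro cong_add cong_mult cong_refl) (simp_all add: D_def)
    ultimately show ?thesis
      by (simp add: v_def cong_def add.assoc)
  qed
  define X :: "(nat \<Rightarrow> nat) set" where "X = {x. \<forall>i\<in>{1..2}. x i \<in> {0..2 - 1}}"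
  have "{a, (a + d) mod int p, (a + e) mod int p, (a + d + e) mod int p} = v ` X" (is "?A = _")
  proof (intro equalityI subsetI)
    fix y assume "y \<in> ?A"
    moreover have "a = v (\<lambda>i. 0)" "(a + d) mod int p = v (\<lambda>i. if i = 1 then 1 else 0)"
      "(a + e) mod int p = v (\<lambda>i. if i = 1 then 0 else 1)" "(a + d + e) mod int p = v (\<lambda>i. 1)"
      using assms(2) unfolding v by simp_all
    moreover have "(\<lambda>i. 0) \<in> X" "(\<lambda>i. if i = 1 then 1 else 0) \<in> X"
      "(\<lambda>i. if i = 1 then 0 else 1) \<in> X" "(\<lambda>i. 1) \<in> X"
      unfolding X_def by simp_all
    ultimately show "y \<in> v ` X"
      by blast
  next
    fix y assume "y \<in> v ` X"
    then obtain x where x: "y = v x" "x \<in> X"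
      by blast
    have "x 1 \<le> 1" "x 2 \<le> 1"
      using x(2) unfolding X_def by simp_all
    then have "x 1 = 0 \<or> x 1 = 1" "x 2 = 0 \<or> x 2 = 1"
      by linarith+
    then show "y \<in> ?A"
      unfolding x(1) v using assms(2) by (elim disjE) simp_all
  qed
  also have "v ` X = {(a + (\<Sum>i=1..2. int (x i) * D i)) mod int p | x :: nat \<Rightarrow> nat.
               \<forall>i\<in>{1..2}. x i \<in> {0..2 - 1}}"
    unfolding v_def X_def image_def by blast
  finally have "is_GAP_dim p 2 ?A"
    unfolding is_GAP_dim_def using assms(2) D
    by (intro exI[of _ a] exI[of _ D] exI[of _ "\<lambda>_. 2"] conjI ballI)
      (simp_all only: carrier_residue_ring_prime[OF assms(1)] simp_thms order_refl)
  then show ?thesis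
    unfolding is_GAP_def by (intro exI[of _ 2]) simp
qed

section \<open>The classification\<close>

theorem theorem1p1:
  fixes p k t :: nat
  assumes "prime p" and "p \<noteq> 2"
    and "k dvd p - 1"
    and "t = (p - 1) div k"
  shows "card (kth_powers p k) = t \<and>
         (is_GAP p (kth_powers p k) \<longleftrightarrow> t = 2 \<or> t = 4 \<or> t = p - 1)"
proof -
  let ?G = "kth_powers p k"
  have p3: "p \<ge> 3"
    using assms(1,2) prime_ge_2_nat[OF assms(1)] by simp
  have kt: "k * t = p - 1"
    using assms(3,4) by simp
  then have "t > 0"
    using p3 by (auto intro!: Nat.gr0I)
  obtain h where bij: "bij_betw (\<lambda>j. h ^ j mod int p) {..<t} ?G" and ht: "[h ^ t = 1] (mod int p)"
    using kth_powers_cyclic[OF assms(1) kt] .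
  have card: "card ?G = t"
    using bij_betw_same_card[OF bij] by simp
  have G_eq: "?G = (\<lambda>j. h ^ j mod int p) ` {..<t}"
    using bij_betw_imp_surj_on[OF bij] by simp
  have inj: "i = j" if "i < t" "j < t" "h ^ i mod int p = h ^ j mod int p" for i j
    using inj_onD[OF bij_betw_imp_inj_on[OF bij], of i j] that by simp
  have "t = 2 \<or> t = 4 \<or> t = p - 1" if gap: "is_GAP p ?G"
  proof (cases "t = p - 1")
    case False
    then have "k \<noteq> 1" "k \<noteq> 0"
      using kt p3 by (intro notI; simp)+
    then have "2 * t \<le> p - 1"
      using mult_le_mono1[of 2 k t] unfolding kt by simp
    then have tp: "int t + 1 < int p"
      using p3 by linarith
    obtain d B where d: "\<not> int p dvd d" and B: "?G = B \<union> (\<lambda>b. (b + d) mod int p) ` B"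
      using GAP_eq_two_translates[OF assms(1) gap] .
    have pow: "[g ^ t = 1] (mod int p)" if g: "g \<in> ?G" for g
    proof -
      obtain j where "g = h ^ j mod int p"
        using g unfolding G_eq by blast
      then have "[g ^ t = (h ^ t) ^ j] (mod int p)"
        by (simp add: cong_def power_mod mult.commute flip: power_mult)
      also have "[(h ^ t) ^ j = 1 ^ j] (mod int p)"
        using ht by (rule cong_pow)
      finally show ?thesis
        by simp
    qed
    have "t = 2 \<or> t = 4"
      using subgroup_eq_two_translates[OF _ kth_powers_subset[OF assms(1)]
          kth_powers_closed[OF assms(1)] pow card \<open>t > 0\<close> tp d B] assms(1)
      by simp
    then show ?thesis
      by blast
  qed simp
  moreover have "is_GAP p ?G" if "t = 2"
  proof -
    have "{..<t} = {0, 1}"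
      using that by auto
    then have "?G = {1, h mod int p}"
      using p3 by (simp add: G_eq)
    also have "\<dots> = (\<lambda>x. (1 + int x * (h - 1)) mod int p) ` {..<2}"
      using p3 by (simp add: lessThan_Suc numeral_2_eq_2 insert_commute)
    finally have G2: "?G = (\<lambda>x. (1 + int x * (h - 1)) mod int p) ` {..<2}" .
    have "\<not> int p dvd h - 1"
      using inj[of 1 0] that by (auto simp: mod_eq_dvd_iff)
    then show ?thesis
      using is_GAP_arithmetic_progression[OF assms(1), of 1 "h - 1" 2] p3 by (simp add: G2)
  qed
  moreover have "is_GAP p ?G" if "t = 4"
  proof -
    \<comment> \<open>The element \<open>h\<^sup>2\<close> of order two is \<open>-1\<close>, so the four powers of \<open>h\<close> are
      \<open>1, h, h\<^sup>3 = -h, h\<^sup>2 = -1\<close>, and \<open>h + h\<^sup>3 = 1 + h\<^sup>2 = 0\<close> makes them a parallelogram.\<close>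
    have "int p dvd (h ^ 2 - 1) * (h ^ 2 + 1)"
      using ht that by (simp add: cong_iff_dvd_diff algebra_simps flip: power_add)
    moreover have "\<not> int p dvd h ^ 2 - 1"
      using inj[of 2 0] that by (auto simp: mod_eq_dvd_iff)
    ultimately have h2: "int p dvd h ^ 2 + 1"
      using assms(1) by (simp add: prime_dvd_mult_iff)
    have "(1 + (h - 1) + (h ^ 3 - 1)) - h ^ 2 = (h - 1) * (h ^ 2 + 1)"
      by (simp add: algebra_simps power2_eq_square power3_eq_cube)
    then have "(1 + (h - 1) + (h ^ 3 - 1)) mod int p = h ^ 2 mod int p"
      using h2 by (simp add: mod_eq_dvd_iff)
    moreover have "{..<t} = {0, 1, 3, 2}"
      using that by auto
    ultimately have "?G = {1, (1 + (h - 1)) mod int p, (1 + (h ^ 3 - 1)) mod int p,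
        (1 + (h - 1) + (h ^ 3 - 1)) mod int p}"
      using p3 by (simp add: G_eq)
    moreover have "\<not> int p dvd h - 1" "\<not> int p dvd h ^ 3 - 1"
      using inj[of 1 0] inj[of 3 0] that by (auto simp: mod_eq_dvd_iff)
    ultimately show ?thesis
      using is_GAP_parallelogram[OF assms(1), of 1 "h - 1" "h ^ 3 - 1"] p3 by simp
  qed
  moreover have "is_GAP p ?G" if "t = p - 1"
  proof -
    have "?G = {1..<int p}"
      using kth_powers_subset[OF assms(1)] card that p3
      by (intro card_subset_eq) auto
    also have "\<dots> = (\<lambda>x. (1 + int x * 1) mod int p) ` {..<p - 1}"
    proof (intro equalityI subsetI)
      fix y assume "y \<in> {1..<int p}"
      then show "y \<in> (\<lambda>x. (1 + int x * 1) mod int p) ` {..<p - 1}"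
        by (intro image_eqI[of _ _ "nat (y - 1)"]) auto
    qed auto
    finally show ?thesis
      using is_GAP_arithmetic_progression[OF assms(1), of 1 1 "p - 1"] p3 by simp
  qed
  ultimately show ?thesis
    using card by blast
qed

end
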